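(* Let $n\ge 1$. (a) For every multiset $\mathcal{M}$ of $n+1$ elements (non-negative integers), the number of plane trees with $n$ edges such that the multiset of heights of all its $n+1$ vertices is $\mathcal{M}$ equals the number of plane trees with $n$ edges such that the multiset of right spanning widths of all its $n+1$ vertices is $\mathcal{M}$. (b) For every $k$ and every multiset $\mathcal{M}'$ (of $k$ non-negative integers), the number of plane trees with $n$ edges and $k$ leaves such that the multiset of heights of its leaves is $\mathcal{M}'$ equals the number of plane trees with $n$ edges and $k$ internal vertices such that the multiset of right spanning widths of its internal vertices is $\mathcal{M}'$.
   Context: A plane tree is a rooted unlabelled tree in which the children of every vertex are linearly ordered (left to right). The height of a vertex $v$ is the number of edges on the unique path from $v$ to the root. A leaf is a non-root vertex without children; every other vertex is internal (the root is always regarded as internal). Right spanning width: for a vertex $v$ of a plane tree $T$, $rsw(v)$ is the number of children of $v$ plus the number of edges attached, from the right-hand side, to the vertices other than $v$ on the path from $v$ to the root. That is, $rsw(v)=\#\{\text{children of }v\}+\sum_{u}\#\{\text{children of }u\text{ strictly to the right of }w_u\}$, where $u$ runs over all proper ancestors of $v$ and $w_u$ is the child of $u$ lying on the path from $v$ to the root (possibly $w_u=v$). *)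

theory Defs
  imports "HOL-Library.Multiset"
begin

datatype plane_tree = Node (children: "plane_tree list")

text \<open>
  A vertex is addressed by the list of child indices (counted from 0, left to right) followed
  on the way from the root to it; the root is the empty list. The vertices on the path from
  the root to \<open>v\<close> are the prefixes \<open>take j v\<close> with \<open>j \<le> length v\<close>.
\<close>

type_synonym vertex = "nat list"

primrec is_vertex :: "vertex \<Rightarrow> plane_tree \<Rightarrow> bool" where
  "is_vertex [] T \<longleftrightarrow> True"
| "is_vertex (i # v) T \<longleftrightarrow> i < length (children T) \<and> is_vertex v (children T ! i)"

definition vertices :: "plane_tree \<Rightarrow> vertex set" where
  "vertices T = {v. is_vertex v T}"

definition edges :: "plane_tree \<Rightarrow> (vertex \<times> vertex) set" where
  "edges T = {(u, u @ [i]) | u i. u @ [i] \<in> vertices T}"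

primrec subtree_at :: "plane_tree \<Rightarrow> vertex \<Rightarrow> plane_tree" where
  "subtree_at T [] = T"
| "subtree_at T (i # v) = subtree_at (children T ! i) v"

definition num_children :: "plane_tree \<Rightarrow> vertex \<Rightarrow> nat" where
  "num_children T v = length (children (subtree_at T v))"

text \<open>The path from \<open>v\<close> to the root has one edge for each entry of the address \<open>v\<close>.\<close>

definition height :: "vertex \<Rightarrow> nat" where
  "height v = length v"

definition leaves :: "plane_tree \<Rightarrow> vertex set" where
  "leaves T = {v \<in> vertices T. v \<noteq> [] \<and> num_children T v = 0}"

definition internal_vertices :: "plane_tree \<Rightarrow> vertex set" where
  "internal_vertices T = vertices T - leaves T"

text \<open>
  The proper ancestors of \<open>v\<close> are \<open>take j v\<close> for \<open>j < length v\<close>, and the child of \<open>take j v\<close>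
  on the path to \<open>v\<close> has index \<open>v ! j\<close>; the children strictly to its right are those with a
  larger index.
\<close>

definition rsw :: "plane_tree \<Rightarrow> vertex \<Rightarrow> nat" where
  "rsw T v = num_children T v + (\<Sum>j<length v. card {v ! j<..<num_children T (take j v)})"

definition plane_trees :: "nat \<Rightarrow> plane_tree set" where
  "plane_trees n = {T. card (edges T) = n}"

text \<open>
  The next lemmas show that \<^const>\<open>card\<close> and \<^const>\<open>mset_set\<close> are only ever applied to finite
  sets of trees and of vertices.
\<close>

lemma vertices_rec:
  "vertices T = insert [] (\<Union>i<length (children T). (#) i ` vertices (children T ! i))"
proof (intro set_eqI)
  fix v show "v \<in> vertices T \<longleftrightarrow>
    v \<in> insert [] (\<Union>i<length (children T). (#) i ` vertices (children T ! i))"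
    by (cases v) (auto simp: vertices_def)
qed

lemma finite_vertices: "finite (vertices T)"
proof (induction T)
  case (Node ts)
  then show ?case by (subst vertices_rec) auto
qed

lemma card_vertices: "card (vertices T) = card (edges T) + 1"
proof -
  have "bij_betw (\<lambda>v. (butlast v, v)) (vertices T - {[]}) (edges T)"
    unfolding bij_betw_def
  proof (intro conjI set_eqI iffI)
    fix e assume "e \<in> edges T"
    then obtain u i where "e = (u, u @ [i])" "u @ [i] \<in> vertices T"
      by (auto simp: edges_def)
    then show "e \<in> (\<lambda>v. (butlast v, v)) ` (vertices T - {[]})"
      by (intro image_eqI[of _ _ "u @ [i]"]) auto
  next
    fix e assume "e \<in> (\<lambda>v. (butlast v, v)) ` (vertices T - {[]})"
    then obtain v where v: "e = (butlast v, v)" "v \<in> vertices T" "v \<noteq> []" by auto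
    then have "v = butlast v @ [last v]" by simp
    with v show "e \<in> edges T" unfolding edges_def by (metis (mono_tags, lifting) mem_Collect_eq)
  qed (auto simp: inj_on_def)
  then have "card (vertices T - {[]}) = card (edges T)" by (rule bij_betw_same_card)
  moreover have "[] \<in> vertices T" by (simp add: vertices_def)
  ultimately show ?thesis
    using finite_vertices[of T] by (metis Suc_eq_plus1 card_Suc_Diff1)
qed

lemma finite_card_vertices_le: "finite {T. card (vertices T) \<le> m}"
proof (induction m)
  case 0
  have "{T. card (vertices T) \<le> 0} = {}" by (simp add: card_vertices)
  then show ?case by (simp only: finite.emptyI)
next
  case (Suc m)
  let ?A = "{T. card (vertices T) \<le> m}"
  have "{T. card (vertices T) \<le> Suc m} \<subseteq> Node ` {ts. set ts \<subseteq> ?A \<and> length ts \<le> m}"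
  proof
    fix T assume "T \<in> {T. card (vertices T) \<le> Suc m}"
    then have c: "card (vertices T) \<le> Suc m" by simp
    have root: "[] \<in> vertices T" by (simp add: vertices_def)
    have d: "card (vertices T - {[]}) \<le> m" 
      using c root finite_vertices[of T] by (simp add: card_Diff_singleton)
    have fin: "finite (vertices T - {[]})" using finite_vertices by simp
    have "length (children T) = card ((\<lambda>i. [i]) ` {..<length (children T)})"
      by (subst card_image) (auto simp: inj_on_def)
    also have "\<dots> \<le> card (vertices T - {[]})"
      by (rule card_mono[OF fin]) (auto simp: vertices_def)
    finally have l: "length (children T) \<le> m" using d by simp
    have "card (vertices t) \<le> m" if t: "t \<in> set (children T)" for t
    proof -
      obtain i where i: "i < length (children T)" "t = children T ! i"
        using t by (metis in_set_conv_nth)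
      have "card (vertices t) = card ((#) i ` vertices t)"
        by (subst card_image) auto
      also have "\<dots> \<le> card (vertices T - {[]})"
        by (rule card_mono[OF fin]) (use i in \<open>auto simp: vertices_def\<close>)
      finally show ?thesis using d by simp
    qed
    with l show "T \<in> Node ` {ts. set ts \<subseteq> ?A \<and> length ts \<le> m}"
      by (intro image_eqI[of _ _ "children T"]) auto
  qed
  moreover have "finite (Node ` {ts. set ts \<subseteq> ?A \<and> length ts \<le> m})"
    using finite_lists_length_le[OF Suc.IH] by simp
  ultimately show ?case by (rule finite_subset)
qed

lemma finite_plane_trees: "finite (plane_trees n)"
  by (rule finite_subset[OF _ finite_card_vertices_le[of "n + 1"]])
    (auto simp: plane_trees_def card_vertices)

end

theory Submission
  imports Defs
begin

text \<open>
  Split a tree with at least one edge into its first subtree \<open>A\<close> and the rest \<open>B\<close>: the heights of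
  \<open>B\<close> are unchanged and those of \<open>A\<close> are raised by one. Split it instead into its last subtree
  \<open>A'\<close> and the rest \<open>B'\<close>: the right spanning widths of \<open>A'\<close> are unchanged and those of \<open>B'\<close> are
  raised by one, the root included. Hence the recursive bijection that sends \<open>(A, B)\<close> to the tree
  with last subtree the image of \<open>B\<close> and rest the image of \<open>A\<close> turns heights into right spanning
  widths. For leaves versus internal vertices the only subtlety is the one-vertex tree: as a first
  subtree it contributes a leaf, as a last subtree it contributes no internal vertex.
\<close>

section \<open>Multisets over disjoint unions, and counting along injections\<close>

lemma image_mset_mset_set_images:
  assumes "finite A" "finite B" "inj_on p A" "inj_on q B" "p ` A \<inter> q ` B = {}"
  shows "image_mset f (mset_set (p ` A \<union> q ` B)) =
    image_mset (\<lambda>x. f (p x)) (mset_set A) + image_mset (\<lambda>x. f (q x)) (mset_set B)"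
  using assms
  by (simp add: mset_set_Union image_mset_mset_set[symmetric] image_mset.compositionality comp_def)

text \<open>An injective self-map of a finite set is onto. So the recursive bijection only has to be
  shown injective and edge-preserving.\<close>

lemma card_Collect_eq_by_inj:
  assumes "finite A" "inj_on f A" "f ` A \<subseteq> A" "\<And>x. x \<in> A \<Longrightarrow> P x \<longleftrightarrow> Q (f x)"
  shows "card {x \<in> A. P x} = card {x \<in> A. Q x}"
proof -
  have "f ` A = A" using assms(1-3) by (metis endo_inj_surj)
  then have "f ` {x \<in> A. P x} = {x \<in> A. Q x}"
    using assms(4) by (auto simp: set_eq_iff image_iff) metis
  moreover have "inj_on f {x \<in> A. P x}" using assms(2) by (rule inj_on_subset) auto
  ultimately show ?thesis by (metis card_image)
qed

section \<open>Addresses after adding a first or a last subtree\<close>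

text \<open>A new first subtree moves every old child of the root one place to the right, which
  changes only the leading index of an address. The root itself stays in place.\<close>

fun shift_vertex :: "vertex \<Rightarrow> vertex" where
  "shift_vertex [] = []"
| "shift_vertex (i # v) = Suc i # v"

lemma inj_shift_vertex: "inj shift_vertex"
proof (rule injI)
  fix u v assume "shift_vertex u = shift_vertex v"
  then show "u = v" by (cases u; cases v) auto
qed

lemma shift_vertex_eq_Nil_iff [simp]: "shift_vertex v = [] \<longleftrightarrow> v = []"
  by (cases v) auto

lemma height_Nil: "height [] = 0"
  by (simp add: height_def)

lemma height_Cons: "height (i # v) = Suc (height v)"
  by (simp add: height_def)

lemma height_shift_vertex: "height (shift_vertex v) = height v"
  by (cases v) (auto simp: height_def)

lemma num_children_Nil [simp]: "num_children (Node ts) [] = length ts"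
  by (simp add: num_children_def)

lemma num_children_Cons [simp]: "num_children (Node ts) (i # v) = num_children (ts ! i) v"
  by (simp add: num_children_def)

lemma num_children_shift_vertex:
  "v \<noteq> [] \<Longrightarrow> num_children (Node (t # ts)) (shift_vertex v) = num_children (Node ts) v"
  by (cases v) auto

lemma num_children_eq_0_root: "num_children T [] = 0 \<longleftrightarrow> T = Node []"
  by (cases T) simp

lemma num_children_pos_root: "0 < num_children T [] \<longleftrightarrow> T \<noteq> Node []"
  by (cases T) simp

lemma Nil_in_vertices [simp]: "[] \<in> vertices T"
  by (simp add: vertices_def)

lemma Cons_in_vertices [simp]:
  "i # v \<in> vertices (Node ts) \<longleftrightarrow> i < length ts \<and> v \<in> vertices (ts ! i)"
  by (simp add: vertices_def)

lemma vertices_single: "vertices (Node []) = {[]}"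
  by (subst vertices_rec) simp

lemma vertices_Cons:
  "vertices (Node (t # ts)) = Cons 0 ` vertices t \<union> shift_vertex ` vertices (Node ts)"
proof (intro set_eqI)
  fix v show "v \<in> vertices (Node (t # ts)) \<longleftrightarrow>
    v \<in> Cons 0 ` vertices t \<union> shift_vertex ` vertices (Node ts)"
  proof (cases v)
    case Nil
    then show ?thesis using image_eqI[of "[]" shift_vertex "[]"] by simp
  next
    case (Cons i u)
    show ?thesis
    proof (cases i)
      case 0
      have "0 # u \<notin> shift_vertex ` X" for X
      proof
        assume "0 # u \<in> shift_vertex ` X"
        then obtain w where "0 # u = shift_vertex w" by blast
        then show False by (cases w) auto
      qed
      with 0 Cons show ?thesis by auto
    next
      case (Suc j)
      have "Suc j # u \<in> shift_vertex ` X \<longleftrightarrow> j # u \<in> X" for X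
        using inj_image_mem_iff[OF inj_shift_vertex, of "j # u" X] by simp
      with Suc Cons show ?thesis by auto
    qed
  qed
qed

lemma Cons_0_shift_disjoint: "Cons 0 ` A \<inter> shift_vertex ` B = {}"
proof -
  have "0 # u \<noteq> shift_vertex v" for u v by (cases v) auto
  then show ?thesis by blast
qed

text \<open>A new last subtree leaves the old addresses alone. The \<open>id\<close> gives the union
  the shape that \<open>image_mset_mset_set_images\<close> expects.\<close>

lemma vertices_snoc:
  "vertices (Node (ts @ [t])) = id ` vertices (Node ts) \<union> Cons (length ts) ` vertices t"
proof (intro set_eqI)
  fix v show "v \<in> vertices (Node (ts @ [t])) \<longleftrightarrow>
    v \<in> id ` vertices (Node ts) \<union> Cons (length ts) ` vertices t"
    by (cases v) (auto simp: nth_append less_Suc_eq)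
qed

lemma vertices_snoc_disjoint: "vertices (Node ts) \<inter> Cons (length ts) ` B = {}"
  by auto

section \<open>Leaves and internal vertices\<close>

lemma leaves_single: "leaves (Node []) = {}"
  by (auto simp: leaves_def vertices_single)

lemma internal_vertices_single: "internal_vertices (Node []) = {[]}"
  by (simp add: internal_vertices_def leaves_single vertices_single)

lemma finite_leaves: "finite (leaves T)"
  by (simp add: leaves_def finite_vertices)

lemma finite_internal_vertices: "finite (internal_vertices T)"
  by (simp add: internal_vertices_def finite_vertices)

lemma in_internal_vertices_iff:
  "v \<in> internal_vertices T \<longleftrightarrow> v \<in> vertices T \<and> (v = [] \<or> num_children T v \<noteq> 0)"
  by (auto simp: internal_vertices_def leaves_def)

text \<open>The root of a one-vertex \<open>t\<close> is internal by convention, but becomes a leaf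
  once \<open>t\<close> hangs below another root. This is the only change of status.\<close>

lemma leaves_Cons:
  "leaves (Node (t # ts)) =
    Cons 0 ` (if t = Node [] then {[]} else leaves t) \<union> shift_vertex ` leaves (Node ts)"
proof -
  have "{v \<in> vertices t. num_children t v = 0} = (if t = Node [] then {[]} else leaves t)"
    by (auto simp: leaves_def vertices_single num_children_eq_0_root)
  moreover have "leaves (Node (t # ts)) =
    Cons 0 ` {v \<in> vertices t. num_children t v = 0} \<union> shift_vertex ` leaves (Node ts)"
    unfolding leaves_def vertices_Cons by (auto simp: num_children_shift_vertex)
  ultimately show ?thesis by simp
qed

text \<open>Counterpart of \<open>leaves_Cons\<close>: the root of a one-vertex \<open>t\<close>
  stops being internal when \<open>t\<close> is attached.\<close>

lemma internal_vertices_snoc: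
  "internal_vertices (Node (ts @ [t])) = id ` internal_vertices (Node ts) \<union>
    Cons (length ts) ` (if t = Node [] then {} else internal_vertices t)"
proof -
  have "{v \<in> vertices t. num_children t v \<noteq> 0} =
      (if t = Node [] then {} else internal_vertices t)"
    by (auto simp: in_internal_vertices_iff vertices_single num_children_pos_root)
  moreover have "internal_vertices (Node (ts @ [t])) = id ` internal_vertices (Node ts) \<union>
    Cons (length ts) ` {v \<in> vertices t. num_children t v \<noteq> 0}"
  proof (intro set_eqI)
    fix v show "v \<in> internal_vertices (Node (ts @ [t])) \<longleftrightarrow>
      v \<in> id ` internal_vertices (Node ts) \<union>
        Cons (length ts) ` {v \<in> vertices t. num_children t v \<noteq> 0}"
      by (cases v) (auto simp: in_internal_vertices_iff nth_append less_Suc_eq)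
  qed
  ultimately show ?thesis by simp
qed

lemma internal_vertices_snoc_disjoint:
  "internal_vertices (Node ts) \<inter> Cons (length ts) ` B = {}"
  using vertices_snoc_disjoint by (auto simp: internal_vertices_def)

section \<open>Right spanning widths after adding a last subtree\<close>

lemma rsw_Nil: "rsw (Node ts) [] = length ts"
  by (simp add: rsw_def)

lemma rsw_Cons: "rsw (Node ts) (i # v) = rsw (ts ! i) v + (length ts - Suc i)"
  \<comment> \<open>The term for index 0, split off from the sum, counts the siblings to the right
    of child \<open>i\<close> of the root.\<close>
  by (simp add: rsw_def sum.lessThan_Suc_shift del: sum.lessThan_Suc)

lemma rsw_snoc_last: "rsw (Node (ts @ [t])) (length ts # v) = rsw t v"
  by (simp add: rsw_Cons)

text \<open>The new edge at the root is one more child if \<open>v\<close> is the root, and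
  otherwise one more edge to the right of the path to \<open>v\<close>.\<close>

lemma rsw_snoc_old:
  "v \<in> vertices (Node ts) \<Longrightarrow> rsw (Node (ts @ [t])) v = Suc (rsw (Node ts) v)"
  by (cases v) (auto simp: rsw_Nil rsw_Cons nth_append)

section \<open>Recursions for the four multisets\<close>

definition height_mset :: "plane_tree \<Rightarrow> nat multiset" where
  "height_mset T = image_mset height (mset_set (vertices T))"

definition rsw_mset :: "plane_tree \<Rightarrow> nat multiset" where
  "rsw_mset T = image_mset (rsw T) (mset_set (vertices T))"

definition leaf_height_mset :: "plane_tree \<Rightarrow> nat multiset" where
  "leaf_height_mset T = image_mset height (mset_set (leaves T))"

definition internal_rsw_mset :: "plane_tree \<Rightarrow> nat multiset" where
  "internal_rsw_mset T = image_mset (rsw T) (mset_set (internal_vertices T))"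

lemma height_mset_Cons:
  "height_mset (Node (t # ts)) = image_mset Suc (height_mset t) + height_mset (Node ts)"
  unfolding height_mset_def vertices_Cons
  by (subst image_mset_mset_set_images)
    (auto simp: finite_vertices Cons_0_shift_disjoint height_shift_vertex height_Nil height_Cons
      image_mset.compositionality comp_def intro: inj_on_subset[OF inj_shift_vertex])

lemma leaf_height_mset_Cons:
  "leaf_height_mset (Node (t # ts)) =
    image_mset Suc (if t = Node [] then {#0#} else leaf_height_mset t) +
    leaf_height_mset (Node ts)"
  unfolding leaf_height_mset_def leaves_Cons
  by (subst image_mset_mset_set_images)
    (auto simp: finite_leaves Cons_0_shift_disjoint height_shift_vertex height_Nil height_Cons
      image_mset.compositionality comp_def intro: inj_on_subset[OF inj_shift_vertex])

lemma rsw_mset_snoc: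
  "rsw_mset (Node (ts @ [t])) = image_mset Suc (rsw_mset (Node ts)) + rsw_mset t"
proof -
  have "image_mset (rsw (Node (ts @ [t]))) (mset_set (vertices (Node ts))) =
      image_mset Suc (rsw_mset (Node ts))"
    unfolding rsw_mset_def image_mset.compositionality
    by (intro image_mset_cong) (simp add: finite_vertices rsw_snoc_old)
  then show ?thesis
    unfolding rsw_mset_def[of "Node (ts @ [t])"] vertices_snoc
    by (subst image_mset_mset_set_images)
      (simp_all add: finite_vertices vertices_snoc_disjoint rsw_snoc_last rsw_mset_def)
qed

lemma internal_rsw_mset_snoc:
  "internal_rsw_mset (Node (ts @ [t])) = image_mset Suc (internal_rsw_mset (Node ts)) +
    (if t = Node [] then {#} else internal_rsw_mset t)"
proof -
  have "image_mset (rsw (Node (ts @ [t]))) (mset_set (internal_vertices (Node ts))) =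
      image_mset Suc (internal_rsw_mset (Node ts))"
    unfolding internal_rsw_mset_def image_mset.compositionality
    by (intro image_mset_cong)
      (simp add: finite_internal_vertices rsw_snoc_old in_internal_vertices_iff)
  then show ?thesis
    unfolding internal_rsw_mset_def[of "Node (ts @ [t])"] internal_vertices_snoc
    by (subst image_mset_mset_set_images)
      (simp_all add: finite_internal_vertices internal_vertices_snoc_disjoint rsw_snoc_last
        internal_rsw_mset_def)
qed

section \<open>The bijection and what it transports\<close>

function height_to_rsw :: "plane_tree \<Rightarrow> plane_tree" where
  "height_to_rsw (Node []) = Node []"
| "height_to_rsw (Node (t # ts)) =
    Node (children (height_to_rsw t) @ [height_to_rsw (Node ts)])"
  by pat_completeness auto
termination by (relation "measure size") auto

lemma height_to_rsw_eq_single_iff: "height_to_rsw T = Node [] \<longleftrightarrow> T = Node []"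
  by (induction T rule: height_to_rsw.induct) auto

lemma height_to_rsw_inject: "height_to_rsw S = height_to_rsw T \<Longrightarrow> S = T"
proof (induction S arbitrary: T rule: height_to_rsw.induct)
  case 1
  then show ?case by (metis height_to_rsw.simps(1) height_to_rsw_eq_single_iff)
next
  case (2 s ss)
  then show ?case
    \<comment> \<open>The last child of the image is the image of the rest; the other children
      determine the image of the first subtree, as a tree is determined by its list of
      children.\<close>
    by (cases T rule: height_to_rsw.cases) (auto dest!: plane_tree.expand)
qed

lemma rsw_mset_height_to_rsw: "rsw_mset (height_to_rsw T) = height_mset T"
proof (induction T rule: height_to_rsw.induct)
  case 1
  then show ?case by (simp add: rsw_mset_def height_mset_def vertices_single rsw_Nil height_def)
next
  case (2 t ts)
  then show ?case by (simp add: rsw_mset_snoc height_mset_Cons)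
qed

text \<open>The one-vertex tree has no leaf but an internal root of width 0. The exceptional value
  \<open>{#0#}\<close> is exactly what \<open>leaf_height_mset_Cons\<close> takes from a one-vertex
  first subtree, so the induction closes.\<close>

lemma internal_rsw_mset_height_to_rsw:
  "internal_rsw_mset (height_to_rsw T) = (if T = Node [] then {#0#} else leaf_height_mset T)"
proof (induction T rule: height_to_rsw.induct)
  case 1
  then show ?case by (simp add: internal_rsw_mset_def internal_vertices_single rsw_Nil)
next
  case (2 t ts)
  \<comment> \<open>Needed when \<open>ts\<close> is empty: the rest then has no leaves, matching
    the empty contribution of a one-vertex last subtree.\<close>
  have "leaf_height_mset (Node []) = {#}"
    by (simp add: leaf_height_mset_def leaves_single)
  with 2 show ?case
    by (auto simp: internal_rsw_mset_snoc leaf_height_mset_Cons height_to_rsw_eq_single_iff)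
qed

text \<open>Each of the two multisets has one element per vertex, so their equality already fixes
  the number of edges.\<close>

lemma card_edges_height_to_rsw: "card (edges (height_to_rsw T)) = card (edges T)"
proof -
  have "size (rsw_mset (height_to_rsw T)) = size (height_mset T)"
    by (simp add: rsw_mset_height_to_rsw)
  then show ?thesis by (simp add: rsw_mset_def height_mset_def card_vertices)
qed

theorem theorem4p2:
  fixes n :: nat
  assumes "n \<ge> 1"
  shows "(\<forall>M :: nat multiset. size M = n + 1 \<longrightarrow>
      card {T \<in> plane_trees n. image_mset height (mset_set (vertices T)) = M} =
      card {T \<in> plane_trees n. image_mset (rsw T) (mset_set (vertices T)) = M}) \<and>
    (\<forall>(k :: nat) (M' :: nat multiset). size M' = k \<longrightarrow>
      card {T \<in> plane_trees n. card (leaves T) = k \<and>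
              image_mset height (mset_set (leaves T)) = M'} =
      card {T \<in> plane_trees n. card (internal_vertices T) = k \<and>
              image_mset (rsw T) (mset_set (internal_vertices T)) = M'})"
proof -
  have inj: "inj_on height_to_rsw (plane_trees n)"
    by (auto intro: inj_onI dest: height_to_rsw_inject)
  have maps: "height_to_rsw ` plane_trees n \<subseteq> plane_trees n"
    by (auto simp: plane_trees_def card_edges_height_to_rsw)
  note transfer = card_Collect_eq_by_inj[OF finite_plane_trees inj maps]
  have internal: "internal_rsw_mset (height_to_rsw T) = leaf_height_mset T"
    if "T \<in> plane_trees n" for T
  proof -
    \<comment> \<open>Since \<open>n \<ge> 1\<close>, the exceptional one-vertex tree does not
      occur.\<close>
    have "card (edges (Node [])) = 0"
      using card_vertices[of "Node []"] by (simp add: vertices_single)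
    then have "T \<noteq> Node []" using that assms by (auto simp: plane_trees_def)
    then show ?thesis by (simp add: internal_rsw_mset_height_to_rsw)
  qed
  \<comment> \<open>Read as sizes of multisets, the conditions on \<open>k\<close> transfer together
    with the multisets themselves.\<close>
  have card_leaves: "card (leaves T) = size (leaf_height_mset T)" for T
    by (simp add: leaf_height_mset_def)
  have card_internal: "card (internal_vertices T) = size (internal_rsw_mset T)" for T
    by (simp add: internal_rsw_mset_def)
  show ?thesis
    unfolding height_mset_def[symmetric] rsw_mset_def[symmetric] leaf_height_mset_def[symmetric]
      internal_rsw_mset_def[symmetric] card_leaves card_internal
    by (intro conjI allI impI transfer) (simp_all add: rsw_mset_height_to_rsw internal)
qed

end
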